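(* Let $CC$ be a C-system and let $\Gamma$ be an object of $CC$. For any objects $X,Y,Z$ over $\Gamma$ one has the (strict) equality of objects $$X\times_{\Gamma}(Y\times_{\Gamma}Z)=(X\times_{\Gamma}Y)\times_{\Gamma}Z.$$
   Context: Composition is written in diagrammatic order: for $f:X\to Y$, $g:Y\to Z$, the composite is $f\circ g:X\to Z$. A C-system $CC$ consists of a category with set of objects $Ob$ and set of morphisms $Mor$, functions $l:Ob\to\mathbb{N}$ and $ft:Ob\to Ob$, an object $pt$, for each $X$ a morphism $p_X:X\to ft(X)$, and for each $X$ with $l(X)>0$ and each $f:Y\to ft(X)$ an object $f^*(X)$ and a morphism $q(f,X):f^*(X)\to X$, such that: $l^{-1}(0)=\{pt\}$; $l(ft(X))=l(X)-1$ if $l(X)>0$; $ft(pt)=pt$; $pt$ is a final object; if $l(X)>0$ and $f:Y\to ft(X)$, then $l(f^*(X))>0$, $ft(f^*(X))=Y$, $p_{f^*(X)}\circ f=q(f,X)\circ p_X$ and this square is a pullback; $Id_{ft(X)}^*(X)=X$ and $q(Id_{ft(X)},X)=Id_X$; for $g:Z\to Y$ and $f:Y\to ft(X)$, $(g\circ f)^*(X)=g^*(f^*(X))$ and $q(g\circ f,X)=q(g,f^*(X))\circ q(f,X)$. $X\ge Y$ ("$X$ is over $Y$") means $l(X)\ge l(Y)$ and $Y=ft^{l(X)-l(Y)}(X)$; $X>Y$ means $X\ge Y$ and $l(X)>l(Y)$. For $X\ge Y$, $p(X,Y):X\to Y$ is defined by $p(X,X)=Id_X$, $p(X,Y)=p_X\circ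 p(ft(X),Y)$ if $X>Y$. For $X\ge\Gamma$ and $f:\Gamma'\to\Gamma$, $f^*(X)$ and $q(f,X):f^*(X)\to X$ are defined recursively by $f^*(\Gamma)=\Gamma'$, $q(f,\Gamma)=f$, and, for $X>\Gamma$, $f^*(X)=q(f,ft(X))^*(X)$, $q(f,X)=q(q(f,ft(X)),X)$. For $X,Y\ge\Gamma$, $X\times_{\Gamma}Y=p(X,\Gamma)^*(Y)$; it is an object over $X$, hence over $\Gamma$. *)

theory Defs
  imports Main
begin

record ('o, 'm) cat =
  Ob :: "'o set"
  Mor :: "'m set"
  src :: "'m \<Rightarrow> 'o"
  tgt :: "'m \<Rightarrow> 'o"
  idn :: "'o \<Rightarrow> 'm"
  cmp :: "'m \<Rightarrow> 'm \<Rightarrow> 'm"  (infixr "\<cdot>\<index>" 70)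

definition hom :: "('o, 'm, 'e) cat_scheme \<Rightarrow> 'o \<Rightarrow> 'o \<Rightarrow> 'm set" where
  "hom C X Y = {f \<in> Mor C. src C f = X \<and> tgt C f = Y}"

text \<open>Composition is diagrammatic: \<open>f \<cdot> g\<close> is first \<open>f\<close>, then \<open>g\<close>.\<close>

locale category =
  fixes C :: "('o, 'm, 'e) cat_scheme" (structure)
  assumes src_closed: "f \<in> Mor C \<Longrightarrow> src C f \<in> Ob C"
    and tgt_closed: "f \<in> Mor C \<Longrightarrow> tgt C f \<in> Ob C"
    and idn_hom: "X \<in> Ob C \<Longrightarrow> idn C X \<in> hom C X X"
    and cmp_hom: "f \<in> hom C X Y \<Longrightarrow> g \<in> hom C Y Z \<Longrightarrow> f \<cdot> g \<in> hom C X Z"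
    and idn_left: "f \<in> hom C X Y \<Longrightarrow> idn C X \<cdot> f = f"
    and idn_right: "f \<in> hom C X Y \<Longrightarrow> f \<cdot> idn C Y = f"
    and cmp_assoc: "f \<in> hom C W X \<Longrightarrow> g \<in> hom C X Y \<Longrightarrow> h \<in> hom C Y Z
      \<Longrightarrow> (f \<cdot> g) \<cdot> h = f \<cdot> (g \<cdot> h)"

definition final_object :: "('o, 'm, 'e) cat_scheme \<Rightarrow> 'o \<Rightarrow> bool" where
  "final_object C T \<longleftrightarrow> T \<in> Ob C \<and> (\<forall>X \<in> Ob C. \<exists>!f. f \<in> hom C X T)"

text \<open>
  \<open>is_pullback C a b f g\<close>: the square with projections \<open>a : P \<rightarrow> A\<close>, \<open>b : P \<rightarrow> B\<close>
  over the cospan \<open>f : A \<rightarrow> D\<close>, \<open>g : B \<rightarrow> D\<close> commutes and is cartesian.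
\<close>

definition is_pullback ::
    "('o, 'm, 'e) cat_scheme \<Rightarrow> 'm \<Rightarrow> 'm \<Rightarrow> 'm \<Rightarrow> 'm \<Rightarrow> bool" where
  "is_pullback C a b f g \<longleftrightarrow>
     (\<exists>P A B D. a \<in> hom C P A \<and> b \<in> hom C P B \<and> f \<in> hom C A D \<and> g \<in> hom C B D \<and>
        cmp C a f = cmp C b g \<and>
        (\<forall>W \<in> Ob C. \<forall>u \<in> hom C W A. \<forall>v \<in> hom C W B. cmp C u f = cmp C v g \<longrightarrow>
           (\<exists>!h. h \<in> hom C W P \<and> cmp C h a = u \<and> cmp C h b = v)))"

text \<open>
  \<open>len\<close>, \<open>ft\<close>, \<open>pt\<close>, \<open>pr\<close> are \<open>l\<close>, \<open>ft\<close>, \<open>pt\<close>, \<open>p\<close>; for \<open>f : Y \<rightarrow> ft X\<close> with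
  \<open>l(X) > 0\<close>, \<open>star1 f X\<close> and \<open>q1 f X\<close> are the primitive \<open>f\<^sup>*(X)\<close> and \<open>q(f,X)\<close>. The values
  of \<open>star1\<close> and \<open>q1\<close> at other arguments are unconstrained.
\<close>

record ('o, 'm) c_sys = "('o, 'm) cat" +
  len :: "'o \<Rightarrow> nat"
  ft :: "'o \<Rightarrow> 'o"
  pt :: 'o
  pr :: "'o \<Rightarrow> 'm"
  star1 :: "'m \<Rightarrow> 'o \<Rightarrow> 'o"
  q1 :: "'m \<Rightarrow> 'o \<Rightarrow> 'm"

locale c_system = category CC for CC :: "('o, 'm, 'e) c_sys_scheme" (structure) +
  assumes ft_closed: "X \<in> Ob CC \<Longrightarrow> ft CC X \<in> Ob CC"
    and pr_hom: "X \<in> Ob CC \<Longrightarrow> pr CC X \<in> hom CC X (ft CC X)"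
    and star1_closed: "X \<in> Ob CC \<Longrightarrow> len CC X > 0 \<Longrightarrow> f \<in> hom CC Y (ft CC X)
      \<Longrightarrow> star1 CC f X \<in> Ob CC"
    and q1_hom: "X \<in> Ob CC \<Longrightarrow> len CC X > 0 \<Longrightarrow> f \<in> hom CC Y (ft CC X)
      \<Longrightarrow> q1 CC f X \<in> hom CC (star1 CC f X) X"
    and len_zero: "{X \<in> Ob CC. len CC X = 0} = {pt CC}"
    and len_ft: "X \<in> Ob CC \<Longrightarrow> len CC X > 0 \<Longrightarrow> len CC (ft CC X) = len CC X - 1"
    and ft_pt: "ft CC (pt CC) = pt CC"
    and pt_final: "final_object CC (pt CC)"
    and len_star1: "X \<in> Ob CC \<Longrightarrow> len CC X > 0 \<Longrightarrow> f \<in> hom CC Y (ft CC X)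
      \<Longrightarrow> len CC (star1 CC f X) > 0"
    and ft_star1: "X \<in> Ob CC \<Longrightarrow> len CC X > 0 \<Longrightarrow> f \<in> hom CC Y (ft CC X)
      \<Longrightarrow> ft CC (star1 CC f X) = Y"
    and star1_square: "X \<in> Ob CC \<Longrightarrow> len CC X > 0 \<Longrightarrow> f \<in> hom CC Y (ft CC X)
      \<Longrightarrow> pr CC (star1 CC f X) \<cdot> f = q1 CC f X \<cdot> pr CC X"
    and star1_pullback: "X \<in> Ob CC \<Longrightarrow> len CC X > 0 \<Longrightarrow> f \<in> hom CC Y (ft CC X)
      \<Longrightarrow> is_pullback CC (pr CC (star1 CC f X)) (q1 CC f X) f (pr CC X)"
    and star1_idn: "X \<in> Ob CC \<Longrightarrow> len CC X > 0 \<Longrightarrow> star1 CC (idn CC (ft CC X)) X = X"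
    and q1_idn: "X \<in> Ob CC \<Longrightarrow> len CC X > 0 \<Longrightarrow> q1 CC (idn CC (ft CC X)) X = idn CC X"
    and star1_cmp: "X \<in> Ob CC \<Longrightarrow> len CC X > 0 \<Longrightarrow> g \<in> hom CC Z Y \<Longrightarrow> f \<in> hom CC Y (ft CC X)
      \<Longrightarrow> star1 CC (g \<cdot> f) X = star1 CC g (star1 CC f X)"
    and q1_cmp: "X \<in> Ob CC \<Longrightarrow> len CC X > 0 \<Longrightarrow> g \<in> hom CC Z Y \<Longrightarrow> f \<in> hom CC Y (ft CC X)
      \<Longrightarrow> q1 CC (g \<cdot> f) X = q1 CC g (star1 CC f X) \<cdot> q1 CC f X"

definition over :: "('o, 'm, 'e) c_sys_scheme \<Rightarrow> 'o \<Rightarrow> 'o \<Rightarrow> bool" where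
  "over CC X Y \<longleftrightarrow> len CC X \<ge> len CC Y \<and> Y = (ft CC ^^ (len CC X - len CC Y)) X"

definition strictly_over :: "('o, 'm, 'e) c_sys_scheme \<Rightarrow> 'o \<Rightarrow> 'o \<Rightarrow> bool" where
  "strictly_over CC X Y \<longleftrightarrow> over CC X Y \<and> len CC X > len CC Y"

text \<open>
  The recursions along \<open>X > \<Gamma>\<close> that define \<open>p(X,\<Gamma>)\<close>, \<open>f\<^sup>*(X)\<close> and \<open>q(f,X)\<close> are run on
  the number \<open>n = l(X) - l(\<Gamma>)\<close> of remaining steps; for \<open>f : \<Gamma>' \<rightarrow> \<Gamma>\<close> the object \<open>\<Gamma>\<close> is
  the target of \<open>f\<close>. The recursion equations in their usual form are proved below.
\<close>

primrec p_steps :: "('o, 'm, 'e) c_sys_scheme \<Rightarrow> nat \<Rightarrow> 'o \<Rightarrow> 'm" where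
  "p_steps CC 0 X = idn CC X"
| "p_steps CC (Suc n) X = cmp CC (pr CC X) (p_steps CC n (ft CC X))"

definition p_mor :: "('o, 'm, 'e) c_sys_scheme \<Rightarrow> 'o \<Rightarrow> 'o \<Rightarrow> 'm" where
  "p_mor CC X Y = p_steps CC (len CC X - len CC Y) X"

primrec q_steps :: "('o, 'm, 'e) c_sys_scheme \<Rightarrow> nat \<Rightarrow> 'm \<Rightarrow> 'o \<Rightarrow> 'm" where
  "q_steps CC 0 f X = f"
| "q_steps CC (Suc n) f X = q1 CC (q_steps CC n f (ft CC X)) X"

primrec star_steps :: "('o, 'm, 'e) c_sys_scheme \<Rightarrow> nat \<Rightarrow> 'm \<Rightarrow> 'o \<Rightarrow> 'o" where
  "star_steps CC 0 f X = src CC f"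
| "star_steps CC (Suc n) f X = star1 CC (q_steps CC n f (ft CC X)) X"

definition q_mor :: "('o, 'm, 'e) c_sys_scheme \<Rightarrow> 'm \<Rightarrow> 'o \<Rightarrow> 'm" where
  "q_mor CC f X = q_steps CC (len CC X - len CC (tgt CC f)) f X"

definition star :: "('o, 'm, 'e) c_sys_scheme \<Rightarrow> 'm \<Rightarrow> 'o \<Rightarrow> 'o" where
  "star CC f X = star_steps CC (len CC X - len CC (tgt CC f)) f X"

definition fib_prod :: "('o, 'm, 'e) c_sys_scheme \<Rightarrow> 'o \<Rightarrow> 'o \<Rightarrow> 'o \<Rightarrow> 'o" where
  "fib_prod CC \<Gamma> X Y = star CC (p_mor CC X \<Gamma>) Y"

context c_system
begin

lemma p_mor_refl: "p_mor CC X X = idn CC X"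
  by (simp add: p_mor_def)

lemma star_base: "f \<in> hom CC \<Gamma>' \<Gamma> \<Longrightarrow> star CC f \<Gamma> = \<Gamma>'"
  by (simp add: star_def hom_def)

lemma q_mor_base: "f \<in> hom CC \<Gamma>' \<Gamma> \<Longrightarrow> q_mor CC f \<Gamma> = f"
  by (simp add: q_mor_def hom_def)

lemma steps_Suc:
  assumes "X \<in> Ob CC" "strictly_over CC X Y"
  shows "len CC X - len CC Y = Suc (len CC (ft CC X) - len CC Y)"
  using assms len_ft[of X] by (auto simp: strictly_over_def)

lemma p_mor_step:
  assumes "X \<in> Ob CC" "strictly_over CC X Y"
  shows "p_mor CC X Y = pr CC X \<cdot> p_mor CC (ft CC X) Y"
  by (simp add: p_mor_def steps_Suc[OF assms])

lemma star_step:
  assumes "X \<in> Ob CC" "strictly_over CC X \<Gamma>" "f \<in> hom CC \<Gamma>' \<Gamma>"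
  shows "star CC f X = star1 CC (q_mor CC f (ft CC X)) X"
  using assms(3) by (simp add: star_def q_mor_def hom_def steps_Suc[OF assms(1,2)])

lemma q_mor_step:
  assumes "X \<in> Ob CC" "strictly_over CC X \<Gamma>" "f \<in> hom CC \<Gamma>' \<Gamma>"
  shows "q_mor CC f X = q1 CC (q_mor CC f (ft CC X)) X"
  using assms(3) by (simp add: q_mor_def hom_def steps_Suc[OF assms(1,2)])

end

end

theory Submission imports Defs begin

text \<open>
  Put \<open>f = p(X,\<Gamma>)\<close>. The left-hand side is \<open>f\<^sup>*(p(Y,\<Gamma>)\<^sup>*(Z))\<close>, where \<open>p(Y,\<Gamma>)\<^sup>*(Z)\<close> is an
  object over \<open>Y\<close>. Pulling it back along \<open>f\<close> therefore builds \<open>f\<^sup>*(Y)\<close> and \<open>q(f,Y)\<close> on the way,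
  and the remaining steps are those of the pullback along \<open>q(f,Y)\<close>
  (\<open>star_via_intermediate\<close>). Since iterated pullback is strictly functorial (\<open>star_comp\<close>),
  the result is \<open>(q(f,Y) \<cdot> p(Y,\<Gamma>))\<^sup>*(Z)\<close>. The square with sides \<open>q(f,Y)\<close> and \<open>f\<close>
  commutes (\<open>q_mor_square\<close>), and canonical projections compose (\<open>p_mor_trans\<close>), so

  \<open>q(f,Y) \<cdot> p(Y,\<Gamma>) = p(f\<^sup>*(Y),X) \<cdot> p(X,\<Gamma>) = p(f\<^sup>*(Y),\<Gamma>)\<close>.

  As \<open>f\<^sup>*(Y)\<close> is \<open>X \<times>\<^sub>\<Gamma> Y\<close>, this is the right-hand side.
\<close>

context c_system
begin

section \<open>Objects over an object\<close>

lemma over_refl: "over CC X X"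
  by (simp add: over_def)

lemma over_trans:
  assumes "over CC X Y" "over CC Y Z"
  shows "over CC X Z"
proof -
  let ?a = "len CC X - len CC Y" and ?b = "len CC Y - len CC Z"
  have le: "len CC Y \<le> len CC X" "len CC Z \<le> len CC Y"
    and Y: "Y = (ft CC ^^ ?a) X" and Z: "Z = (ft CC ^^ ?b) Y"
    using assms unfolding over_def by blast+
  have "Z = (ft CC ^^ ?b) ((ft CC ^^ ?a) X)"
    using Y Z by metis
  also have "\<dots> = (ft CC ^^ (?b + ?a)) X"
    by (simp add: funpow_add)
  also have "?b + ?a = len CC X - len CC Z"
    using le by simp
  finally show ?thesis
    using le by (simp add: over_def)
qed

lemma over_Ob:
  assumes "X \<in> Ob CC" "over CC X Y"
  shows "Y \<in> Ob CC"
proof -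
  have "(ft CC ^^ n) X \<in> Ob CC" for n
    using assms(1) ft_closed by (induction n) auto
  then show ?thesis
    using assms(2) unfolding over_def by metis
qed

lemma over_ft:
  assumes "X \<in> Ob CC" "strictly_over CC X Y"
  shows "over CC (ft CC X) Y"
  using assms(2) steps_Suc[OF assms] len_ft[OF assms(1)]
  by (auto simp: strictly_over_def over_def funpow_Suc_right simp del: funpow.simps)

lemma strictly_over_if_over_ft:
  assumes "X \<in> Ob CC" "len CC X > 0" "over CC (ft CC X) Y"
  shows "strictly_over CC X Y"
proof -
  have "len CC X - len CC Y = Suc (len CC (ft CC X) - len CC Y)" "len CC Y < len CC X"
    using assms len_ft[of X] by (auto simp: over_def)
  then show ?thesis
    using assms(3)
    by (auto simp: strictly_over_def over_def funpow_Suc_right simp del: funpow.simps)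
qed

text \<open>
  The recursions for \<open>p(X,\<Gamma>)\<close>, \<open>f\<^sup>*(X)\<close> and \<open>q(f,X)\<close> all descend from \<open>X\<close> to \<open>\<Gamma>\<close> one
  application of \<open>ft\<close> at a time; this is the induction principle that matches them.
\<close>

lemma over_induct [consumes 2, case_names base step]:
  assumes "X \<in> Ob CC" "over CC X Y"
    and base: "P Y"
    and step: "\<And>X. X \<in> Ob CC \<Longrightarrow> strictly_over CC X Y \<Longrightarrow> ft CC X \<in> Ob CC
      \<Longrightarrow> len CC X > 0 \<Longrightarrow> over CC (ft CC X) Y \<Longrightarrow> P (ft CC X) \<Longrightarrow> P X"
  shows "P X"
  using assms(1,2)
proof (induction "len CC X - len CC Y" arbitrary: X)
  case 0
  then have "X = Y" by (simp add: over_def)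
  then show ?case using base by simp
next
  case (Suc n)
  then have X: "X \<in> Ob CC" and s: "strictly_over CC X Y"
    by (auto simp: strictly_over_def)
  have "P (ft CC X)"
    using Suc.hyps(1)[OF _ ft_closed[OF X] over_ft[OF X s]] Suc.hyps(2) steps_Suc[OF X s] by simp
  then show ?case
    using step[OF X s ft_closed[OF X] _ over_ft[OF X s]] s by (auto simp: strictly_over_def)
qed

section \<open>Canonical projections\<close>

lemma p_mor_hom:
  assumes "X \<in> Ob CC" "over CC X Y"
  shows "p_mor CC X Y \<in> hom CC X Y"
  using assms
proof (induction rule: over_induct)
  case base
  show ?case using over_Ob[OF assms] by (simp add: p_mor_refl idn_hom)
next
  case (step X)
  then show ?case using cmp_hom[OF pr_hom[OF step(1)] step(6)] by (simp add: p_mor_step)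
qed

lemma p_mor_trans:
  assumes "X \<in> Ob CC" "over CC X Y" "over CC Y Z"
  shows "p_mor CC X Y \<cdot> p_mor CC Y Z = p_mor CC X Z"
  using assms(1,2)
proof (induction rule: over_induct)
  case base
  have "p_mor CC Y Z \<in> hom CC Y Z"
    using p_mor_hom over_Ob assms by blast
  then show ?case by (simp add: p_mor_refl idn_left)
next
  case (step X)
  have Y: "Y \<in> Ob CC" using over_Ob assms by blast
  have "strictly_over CC X Z"
    using strictly_over_if_over_ft step over_trans assms(3) by blast
  then show ?case
    using step cmp_assoc[OF pr_hom p_mor_hom p_mor_hom[OF Y assms(3)]] by (simp add: p_mor_step)
qed

section \<open>Iterated pullback\<close>

lemma hom_src_Ob: "f \<in> hom CC X Y \<Longrightarrow> X \<in> Ob CC"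
  using src_closed by (auto simp: hom_def)

text \<open>
  The morphism \<open>q(f,X)\<close> has the right source and target only because \<open>f\<^sup>*(ft(X))\<close> is an
  object with a well-typed \<open>q(f,ft(X))\<close>, so all three claims go through the recursion together.
\<close>

lemma star_q_mor_typing:
  assumes "X \<in> Ob CC" "over CC X \<Gamma>" "f \<in> hom CC \<Gamma>' \<Gamma>"
  shows "star CC f X \<in> Ob CC \<and> over CC (star CC f X) \<Gamma>' \<and> q_mor CC f X \<in> hom CC (star CC f X) X"
  using assms(1,2)
proof (induction rule: over_induct)
  case base
  then show ?case
    using assms(3) hom_src_Ob by (simp add: star_base[OF assms(3)] q_mor_base[OF assms(3)] over_refl)
next
  case (step X)
  let ?q = "q_mor CC f (ft CC X)"
  have q: "?q \<in> hom CC (star CC f (ft CC X)) (ft CC X)"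
    using step by simp
  have S: "star1 CC ?q X \<in> Ob CC"
    using star1_closed[OF _ _ q] step by simp
  have "over CC (star1 CC ?q X) \<Gamma>'"
    using strictly_over_if_over_ft[OF S] len_star1[OF _ _ q] ft_star1[OF _ _ q] step
    by (simp add: strictly_over_def)
  then show ?case
    using S q1_hom[OF _ _ q] step
    by (simp add: star_step[OF _ _ assms(3)] q_mor_step[OF _ _ assms(3)])
qed

lemma star_Ob: "X \<in> Ob CC \<Longrightarrow> over CC X \<Gamma> \<Longrightarrow> f \<in> hom CC \<Gamma>' \<Gamma> \<Longrightarrow> star CC f X \<in> Ob CC"
  and star_over: "X \<in> Ob CC \<Longrightarrow> over CC X \<Gamma> \<Longrightarrow> f \<in> hom CC \<Gamma>' \<Gamma> \<Longrightarrow> over CC (star CC f X) \<Gamma>'"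
  and q_mor_hom: "X \<in> Ob CC \<Longrightarrow> over CC X \<Gamma> \<Longrightarrow> f \<in> hom CC \<Gamma>' \<Gamma>
    \<Longrightarrow> q_mor CC f X \<in> hom CC (star CC f X) X"
  using star_q_mor_typing by blast+

lemma star_strictly_over:
  assumes "X \<in> Ob CC" "strictly_over CC X \<Gamma>" "f \<in> hom CC \<Gamma>' \<Gamma>"
  shows "ft CC (star CC f X) = star CC f (ft CC X)" "strictly_over CC (star CC f X) \<Gamma>'"
proof -
  have l: "len CC X > 0" using assms(2) by (auto simp: strictly_over_def)
  note X' = ft_closed[OF assms(1)] over_ft[OF assms(1,2)] assms(3)
  note q = q_mor_hom[OF X']
  show f: "ft CC (star CC f X) = star CC f (ft CC X)"
    using ft_star1[OF assms(1) l q] by (simp add: star_step[OF assms])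
  show "strictly_over CC (star CC f X) \<Gamma>'"
  proof (rule strictly_over_if_over_ft)
    show "star CC f X \<in> Ob CC" "len CC (star CC f X) > 0"
      using star1_closed[OF assms(1) l q] len_star1[OF assms(1) l q] by (simp_all add: star_step[OF assms])
    show "over CC (ft CC (star CC f X)) \<Gamma>'"
      using star_over[OF X'] f by simp
  qed
qed

text \<open>
  Pasting the commuting squares of the single steps, one for each object between \<open>X\<close> and
  \<open>\<Gamma>\<close>, on top of each other.
\<close>

lemma q_mor_square:
  assumes "X \<in> Ob CC" "over CC X \<Gamma>" "f \<in> hom CC \<Gamma>' \<Gamma>"
  shows "q_mor CC f X \<cdot> p_mor CC X \<Gamma> = p_mor CC (star CC f X) \<Gamma>' \<cdot> f"
  using assms(1,2)
proof (induction rule: over_induct)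
  case base
  show ?case
    using assms(3) by (simp add: star_base[OF assms(3)] q_mor_base[OF assms(3)] p_mor_refl idn_left idn_right)
next
  case (step X)
  let ?S = "star CC f X" and ?S' = "star CC f (ft CC X)" and ?q = "q_mor CC f (ft CC X)"
  have oX: "over CC X \<Gamma>" using step by (simp add: strictly_over_def)
  note S = star_Ob[OF step(1) oX assms(3)]
  note S' = star_Ob[OF step(3,5) assms(3)] star_over[OF step(3,5) assms(3)]
  note q' = q_mor_hom[OF step(3,5) assms(3)]
  note ftS = star_strictly_over[OF step(1,2) assms(3)]
  have prS: "pr CC ?S \<in> hom CC ?S ?S'" using pr_hom[OF S] ftS by simp
  have "q_mor CC f X \<cdot> p_mor CC X \<Gamma> = q_mor CC f X \<cdot> (pr CC X \<cdot> p_mor CC (ft CC X) \<Gamma>)"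
    using step by (simp add: p_mor_step)
  also have "\<dots> = (q_mor CC f X \<cdot> pr CC X) \<cdot> p_mor CC (ft CC X) \<Gamma>"
    using cmp_assoc[OF q_mor_hom[OF step(1) oX assms(3)] pr_hom[OF step(1)] p_mor_hom[OF step(3,5)]]
    by simp
  also have "q_mor CC f X \<cdot> pr CC X = pr CC ?S \<cdot> ?q"
    using star1_square[OF step(1,4) q']
    by (simp add: star_step[OF step(1,2) assms(3)] q_mor_step[OF step(1,2) assms(3)])
  also have "(pr CC ?S \<cdot> ?q) \<cdot> p_mor CC (ft CC X) \<Gamma> = pr CC ?S \<cdot> (?q \<cdot> p_mor CC (ft CC X) \<Gamma>)"
    by (rule cmp_assoc[OF prS q' p_mor_hom[OF step(3,5)]])
  also have "\<dots> = pr CC ?S \<cdot> (p_mor CC ?S' \<Gamma>' \<cdot> f)"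
    using step by simp
  also have "\<dots> = (pr CC ?S \<cdot> p_mor CC ?S' \<Gamma>') \<cdot> f"
    using cmp_assoc[OF prS p_mor_hom[OF S'] assms(3)] by simp
  also have "\<dots> = p_mor CC ?S \<Gamma>' \<cdot> f"
    using p_mor_step[OF S ftS(2)] ftS(1) by simp
  finally show ?case .
qed

text \<open>
  For \<open>W\<close> over \<open>Y\<close> over \<open>\<Gamma>\<close>, the recursion for \<open>f\<^sup>*(W)\<close> first reaches \<open>Y\<close> and then continues
  as the recursion for the pullback along \<open>q(f,Y)\<close>, because both have the value \<open>q(f,Y)\<close> there.
\<close>

lemma star_q_mor_via_intermediate:
  assumes "W \<in> Ob CC" "over CC W Y" "over CC Y \<Gamma>" "f \<in> hom CC \<Gamma>' \<Gamma>"
  shows "star CC f W = star CC (q_mor CC f Y) W \<and> q_mor CC f W = q_mor CC (q_mor CC f Y) W"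
proof -
  note q = q_mor_hom[OF over_Ob[OF assms(1,2)] assms(3,4)]
  show ?thesis
    using assms(1,2)
  proof (induction rule: over_induct)
    case base
    show ?case by (simp add: star_base[OF q] q_mor_base[OF q])
  next
    case (step W)
    have "strictly_over CC W \<Gamma>"
      using strictly_over_if_over_ft step over_trans assms(3) by blast
    then show ?case
      using step by (simp add: star_step[OF _ _ q] q_mor_step[OF _ _ q]
          star_step[OF _ _ assms(4)] q_mor_step[OF _ _ assms(4)])
  qed
qed

lemmas star_via_intermediate = star_q_mor_via_intermediate[THEN conjunct1]

text \<open>
  Functoriality of iterated pullback follows from that of the single steps. The equation for
  objects needs the one for morphisms one level down, so they are proved simultaneously.
\<close>

lemma star_q_mor_comp:
  assumes "X \<in> Ob CC" "over CC X \<Gamma>" "f \<in> hom CC \<Gamma>' \<Gamma>" "g \<in> hom CC \<Gamma>'' \<Gamma>'"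
  shows "star CC (g \<cdot> f) X = star CC g (star CC f X) \<and>
    q_mor CC (g \<cdot> f) X = q_mor CC g (star CC f X) \<cdot> q_mor CC f X"
proof -
  note gf = cmp_hom[OF assms(4,3)]
  show ?thesis
    using assms(1,2)
  proof (induction rule: over_induct)
    case base
    show ?case
      by (simp add: star_base[OF gf] q_mor_base[OF gf] star_base[OF assms(3)]
          q_mor_base[OF assms(3)] star_base[OF assms(4)] q_mor_base[OF assms(4)])
  next
    case (step X)
    let ?S = "star CC f X" and ?S' = "star CC f (ft CC X)"
    have oX: "over CC X \<Gamma>" using step by (simp add: strictly_over_def)
    note S = star_Ob[OF step(1) oX assms(3)]
    note S' = star_Ob[OF step(3,5) assms(3)] star_over[OF step(3,5) assms(3)]
    note ftS = star_strictly_over[OF step(1,2) assms(3)]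
    note qf = q_mor_hom[OF step(3,5) assms(3)]
    note qg = q_mor_hom[OF S' assms(4)]
    have "q_mor CC (g \<cdot> f) (ft CC X) = q_mor CC g ?S' \<cdot> q_mor CC f (ft CC X)"
      using step by simp
    then have gf_X: "star CC (g \<cdot> f) X = star1 CC (q_mor CC g ?S' \<cdot> q_mor CC f (ft CC X)) X"
      "q_mor CC (g \<cdot> f) X = q1 CC (q_mor CC g ?S' \<cdot> q_mor CC f (ft CC X)) X"
      by (simp_all add: star_step[OF step(1,2) gf] q_mor_step[OF step(1,2) gf])
    have g_S: "star CC g ?S = star1 CC (q_mor CC g ?S') ?S"
      "q_mor CC g ?S = q1 CC (q_mor CC g ?S') ?S"
      by (simp_all add: star_step[OF S ftS(2) assms(4)] q_mor_step[OF S ftS(2) assms(4)] ftS(1))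
    show ?case
      unfolding gf_X g_S
      using star1_cmp[OF step(1,4) qg qf] q1_cmp[OF step(1,4) qg qf]
      by (simp add: star_step[OF step(1,2) assms(3)] q_mor_step[OF step(1,2) assms(3)])
  qed
qed

lemmas star_comp = star_q_mor_comp[THEN conjunct1]

section \<open>Associativity of the fibre product\<close>

lemma fib_prod_assoc:
  assumes "X \<in> Ob CC" "Y \<in> Ob CC" "Z \<in> Ob CC"
    and "over CC X \<Gamma>" "over CC Y \<Gamma>" "over CC Z \<Gamma>"
  shows "fib_prod CC \<Gamma> X (fib_prod CC \<Gamma> Y Z) = fib_prod CC \<Gamma> (fib_prod CC \<Gamma> X Y) Z"
proof -
  let ?f = "p_mor CC X \<Gamma>" and ?g = "p_mor CC Y \<Gamma>"
  note f = p_mor_hom[OF assms(1,4)] and g = p_mor_hom[OF assms(2,5)]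
  let ?P = "star CC ?f Y" and ?W = "star CC ?g Z"
  note P = star_Ob[OF assms(2,5) f] star_over[OF assms(2,5) f]
  have "star CC ?f ?W = star CC (q_mor CC ?f Y) ?W"
    by (rule star_via_intermediate[OF star_Ob[OF assms(3,6) g] star_over[OF assms(3,6) g] assms(5) f])
  also have "\<dots> = star CC (q_mor CC ?f Y \<cdot> ?g) Z"
    by (rule star_comp[OF assms(3,6) g q_mor_hom[OF assms(2,5) f], symmetric])
  also have "q_mor CC ?f Y \<cdot> ?g = p_mor CC ?P X \<cdot> ?f"
    by (rule q_mor_square[OF assms(2,5) f])
  also have "\<dots> = p_mor CC ?P \<Gamma>"
    by (rule p_mor_trans[OF P assms(4)])
  finally show ?thesis
    by (simp add: fib_prod_def)
qed

end

theorem lemma0p2p22: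
  fixes CC :: "('o, 'm, 'e) c_sys_scheme" and \<Gamma> X Y Z :: 'o
  assumes "c_system CC"
    and "\<Gamma> \<in> Ob CC" and "X \<in> Ob CC" and "Y \<in> Ob CC" and "Z \<in> Ob CC"
    and "over CC X \<Gamma>" and "over CC Y \<Gamma>" and "over CC Z \<Gamma>"
  shows "fib_prod CC \<Gamma> X (fib_prod CC \<Gamma> Y Z) = fib_prod CC \<Gamma> (fib_prod CC \<Gamma> X Y) Z"
  by (rule c_system.fib_prod_assoc[OF assms(1,3,4,5,6,7,8)])

end
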